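(* Let $\mathcal L$ be a finite meet-semilattice, let $\mathcal F$ be a sorted family in $\mathcal L$ and consider a subset $\mathcal C$ of the underlying set $\mathcal S_{\mathcal F}$. If there exists a building set $\mathcal S$ of $\mathcal L$ with $\mathcal S_{\mathcal F}\subseteq\mathcal S$ such that $\mathcal C$ is nested in $\mathcal S$, then $\bigvee_{\xi\in\mathcal C}(\xi,0)$ exists in the blow-up $\mathrm{Bl}_{\mathcal F}(\mathcal L)$.
   Context: A finite (meet-)semilattice is a finite poset $(\mathcal L,\le)$ in which every non-empty subset has a greatest lower bound (meet $\wedge$). It has a unique minimal element $0$. For $\mathcal X\subseteq\mathcal L$ the set of upper bounds is either empty or has a unique minimal element, the join $\bigvee\mathcal X$ (which is then said to exist). Blow-up: For $\xi\in\mathcal L$, $\mathrm{Bl}_{(\xi)}(\mathcal L)$ is the semilattice consisting of all $x\in\mathcal L$ with $x\not\ge\xi$ and all pairs $(\xi,x)$ with $x\in\mathcal L$, $x\not\ge\xi$ and such that $x\vee\xi$ exists. Its strict order is: $x>_{\mathrm{Bl}}y$ if $x>y$; $(\xi,x)>_{\mathrm{Bl}}(\xi,y)$ if $x>y$; $(\xi,x)>_{\mathrm{Bl}}y$ if $x\ge y$ (with $x,y\not\ge\xi$ in all cases). For a family $\mathcal F=(\xi_1,\ldots,\xi_r)$ of pairwise distinct elements of $\mathcal L$, $\mathrm{Bl}_{\mathcal F}(\mathcal L)$ is the subsequent blow-up of $\mathcal L$ in $\xi_1,\xi_2,\ldots,\xi_r$ in order of ascending indices. The family is sorted if $\xi_i>\xi_j$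 implies $i<j$. $\mathcal S_{\mathcal F}=\{\xi_1,\ldots,\xi_r\}$ denotes its underlying set. For $\xi=\xi_i$, $(\xi,0)$ denotes the element created when blowing up $\xi_i$; it persists in all later blow-ups. Building set: A subset $\mathcal S\subseteq\mathcal L\setminus\{0\}$ is a building set for $\mathcal L$ if for every $x\in\mathcal L\setminus\{0\}$, writing $\max(\mathcal S_{\le x})=\{x_1,\ldots,x_k\}$ for the maximal elements of $\mathcal S_{\le x}=\{s\in\mathcal S;\ s\le x\}$, there is an isomorphism of posets $\prod_{j=1}^k[0,x_j]\to[0,x]$ mapping $(0,\ldots,0,x_j,0,\ldots,0)$ (with $x_j$ in the $j$-th place) to $x_j$ for each $j$. Nested: For $\mathcal C\subseteq\mathcal S\subseteq\mathcal L$, $\mathcal C$ is nested in $\mathcal S$ if for every subset $\mathcal H\subseteq\mathcal C$ of pairwise incomparable elements with $|\mathcal H|\ge2$ the join $\bigvee\mathcal H$ exists and does not lie in $\mathcal S$. *)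

theory Defs
  imports "HOL-Algebra.Lattice"
begin

definition finite_semilattice :: "'a gorder \<Rightarrow> bool" where
  "finite_semilattice L \<longleftrightarrow> partial_order L \<and> finite (carrier L) \<and> carrier L \<noteq> {} \<and>
     (\<forall>X \<subseteq> carrier L. X \<noteq> {} \<longrightarrow> (\<exists>m. is_glb L m X))"

text \<open>
  \<^const>\<open>Upper\<close> silently ignores elements outside the carrier, hence the first conjunct.
\<close>

definition has_join :: "'a gorder \<Rightarrow> 'a set \<Rightarrow> bool" where
  "has_join L X \<longleftrightarrow> X \<subseteq> carrier L \<and> (\<exists>j. is_lub L j X)"


section \<open>Blow-ups\<close>

text \<open>
  \<open>Orig x\<close> is an element of the semilattice we start from and \<open>Exc \<xi> x\<close> is the pair \<open>(\<xi>, x)\<close>.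
  The type is recursive since the second component of a pair created by a later blow-up may
  itself be a pair.
\<close>

datatype 'a blowup_elem = Orig 'a | Exc "'a blowup_elem" "'a blowup_elem"

definition blowup_kept :: "'b gorder \<Rightarrow> 'b \<Rightarrow> 'b set" where
  "blowup_kept L \<xi> = {x \<in> carrier L. \<not> \<xi> \<sqsubseteq>\<^bsub>L\<^esub> x}"

inductive blowup_less ::
  "'a blowup_elem gorder \<Rightarrow> 'a blowup_elem \<Rightarrow> 'a blowup_elem \<Rightarrow> 'a blowup_elem \<Rightarrow> bool"
  for L \<xi> where
  "\<lbrakk>x \<in> blowup_kept L \<xi>; y \<in> blowup_kept L \<xi>; y \<sqsubset>\<^bsub>L\<^esub> x\<rbrakk> \<Longrightarrow> blowup_less L \<xi> y x"
| "\<lbrakk>x \<in> blowup_kept L \<xi>; y \<in> blowup_kept L \<xi>; y \<sqsubset>\<^bsub>L\<^esub> x\<rbrakk> \<Longrightarrow> blowup_less L \<xi> (Exc \<xi> y) (Exc \<xi> x)"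
| "\<lbrakk>x \<in> blowup_kept L \<xi>; y \<in> blowup_kept L \<xi>; y \<sqsubseteq>\<^bsub>L\<^esub> x\<rbrakk> \<Longrightarrow> blowup_less L \<xi> y (Exc \<xi> x)"

text \<open>
  This is the blow-up of \<open>L\<close> in \<open>\<xi>\<close> provided that \<open>L\<close> does not already contain an element of
  the form \<open>Exc \<xi> x\<close>; see lemma \<open>Exc_fresh\<close> below.
\<close>

definition blowup :: "'a blowup_elem gorder \<Rightarrow> 'a blowup_elem \<Rightarrow> 'a blowup_elem gorder" where
  "blowup L \<xi> =
     \<lparr> carrier = blowup_kept L \<xi> \<union> Exc \<xi> ` {x \<in> blowup_kept L \<xi>. has_join L {x, \<xi>}},
       eq = (=),
       le = (\<lambda>u v. u = v \<or> blowup_less L \<xi> u v) \<rparr>"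

definition orig_poset :: "'a gorder \<Rightarrow> 'a blowup_elem gorder" where
  "orig_poset L =
     \<lparr> carrier = Orig ` carrier L,
       eq = (=),
       le = (\<lambda>u v. \<exists>x y. u = Orig x \<and> v = Orig y \<and> x \<sqsubseteq>\<^bsub>L\<^esub> y) \<rparr>"

definition blowup_family :: "'a gorder \<Rightarrow> 'a list \<Rightarrow> 'a blowup_elem gorder" where
  "blowup_family L F = foldl (\<lambda>M \<xi>. blowup M (Orig \<xi>)) (orig_poset L) F"

lemma Exc_fresh:
  assumes "Exc (Orig \<xi>) x \<in> carrier (blowup_family L F)"
  shows "\<xi> \<in> set F"
  using assms
proof (induction F rule: rev_induct)
  case Nil
  then show ?case by (auto simp: blowup_family_def orig_poset_def)
next
  case (snoc a F)
  then show ?case by (auto simp: blowup_family_def blowup_def blowup_kept_def)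
qed

definition family_in :: "'a gorder \<Rightarrow> 'a list \<Rightarrow> bool" where
  "family_in L F \<longleftrightarrow> set F \<subseteq> carrier L \<and> distinct F"

definition sorted_family :: "'a gorder \<Rightarrow> 'a list \<Rightarrow> bool" where
  "sorted_family L F \<longleftrightarrow>
     (\<forall>i < length F. \<forall>j < length F. F ! j \<sqsubset>\<^bsub>L\<^esub> F ! i \<longrightarrow> i < j)"

text \<open>
  The element \<open>(\<xi>, 0)\<close>; the bottom element of every intermediate blow-up is \<open>Orig \<bottom>\<^bsub>L\<^esub>\<close>
  as long as one does not blow up in \<open>\<bottom>\<^bsub>L\<^esub>\<close>.
\<close>

definition exc_elem :: "'a gorder \<Rightarrow> 'a \<Rightarrow> 'a blowup_elem" where
  "exc_elem L \<xi> = Exc (Orig \<xi>) (Orig \<bottom>\<^bsub>L\<^esub>)"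


section \<open>Building sets and nested sets\<close>

definition interval_poset :: "'a gorder \<Rightarrow> 'a \<Rightarrow> 'a \<Rightarrow> 'a gorder" where
  "interval_poset L a b = L\<lparr>carrier := \<lbrace>a..b\<rbrace>\<^bsub>L\<^esub>\<rparr>"

definition product_poset :: "'i set \<Rightarrow> ('i \<Rightarrow> 'a gorder) \<Rightarrow> ('i \<Rightarrow> 'a) gorder" where
  "product_poset I P =
     \<lparr> carrier = (\<Pi>\<^sub>E i\<in>I. carrier (P i)),
       eq = (=),
       le = (\<lambda>f g. \<forall>i\<in>I. f i \<sqsubseteq>\<^bsub>P i\<^esub> g i) \<rparr>"

definition poset_iso :: "'a gorder \<Rightarrow> 'b gorder \<Rightarrow> ('a \<Rightarrow> 'b) \<Rightarrow> bool" where
  "poset_iso P Q h \<longleftrightarrow> order_emb P Q h \<and> bij_betw h (carrier P) (carrier Q)"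

definition maximal_elems :: "'a gorder \<Rightarrow> 'a set \<Rightarrow> 'a set" where
  "maximal_elems L X = {x \<in> X. \<not> (\<exists>y\<in>X. x \<sqsubset>\<^bsub>L\<^esub> y)}"

text \<open>
  The factors of the product are indexed by the maximal elements themselves.
\<close>

definition building_set :: "'a gorder \<Rightarrow> 'a set \<Rightarrow> bool" where
  "building_set L S \<longleftrightarrow> S \<subseteq> carrier L - {\<bottom>\<^bsub>L\<^esub>} \<and>
     (\<forall>x \<in> carrier L - {\<bottom>\<^bsub>L\<^esub>}.
        let M = maximal_elems L {s \<in> S. s \<sqsubseteq>\<^bsub>L\<^esub> x} in
        \<exists>h. poset_iso (product_poset M (\<lambda>m. interval_poset L \<bottom>\<^bsub>L\<^esub> m)) (interval_poset L \<bottom>\<^bsub>L\<^esub> x) h \<and>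
            (\<forall>m\<in>M. h (\<lambda>i\<in>M. if i = m then m else \<bottom>\<^bsub>L\<^esub>) = m))"

definition pairwise_incomparable :: "'a gorder \<Rightarrow> 'a set \<Rightarrow> bool" where
  "pairwise_incomparable L H \<longleftrightarrow>
     pairwise (\<lambda>x y. \<not> x \<sqsubseteq>\<^bsub>L\<^esub> y \<and> \<not> y \<sqsubseteq>\<^bsub>L\<^esub> x) H"

definition nested_in :: "'a gorder \<Rightarrow> 'a set \<Rightarrow> 'a set \<Rightarrow> bool" where
  "nested_in L C S \<longleftrightarrow> C \<subseteq> S \<and> S \<subseteq> carrier L \<and>
     (\<forall>H \<subseteq> C. pairwise_incomparable L H \<and> card H \<ge> 2 \<longrightarrow> has_join L H \<and> \<Squnion>\<^bsub>L\<^esub> H \<notin> S)"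

end

theory Submission
  imports Defs
begin

text \<open>
  An element of \<open>Bl\<^sub>F(L)\<close> is a pair of an element \<open>x\<close> of \<open>L\<close> and a set \<open>T\<close> of centers, and the order
  is the componentwise one.  Hence the join of the \<open>(\<xi>, 0)\<close> with \<open>\<xi> \<in> C\<close> must be the pair
  \<open>(0, C)\<close>, provided it belongs to the blow-up.  Reading the family backwards, this holds if no
  center \<open>\<xi>\<close> lies below the join of those elements of \<open>C\<close> that come after \<open>\<xi>\<close>.  In a building
  set, an element below the join of a nested set lies below one of its members, so the family
  being sorted excludes this.
\<close>

section \<open>Nested sets in finite semilattices\<close>

locale fin_semilattice =
  fixes L (structure)
  assumes semilattice: "finite_semilattice L"

sublocale fin_semilattice \<subseteq> partial_order L
  using semilattice by (simp add: finite_semilattice_def)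

sublocale fin_semilattice \<subseteq> weak_partial_order_bottom L
proof
  obtain m where "is_glb L m (carrier L)"
    using semilattice by (auto simp: finite_semilattice_def)
  then have "least L m (carrier L)"
    by (auto simp: greatest_def least_def Lower_def)
  then show "\<exists>x. least L x (carrier L)" ..
qed

context fin_semilattice
begin

lemma finite_carrier: "finite (carrier L)"
  using semilattice by (simp add: finite_semilattice_def)

lemma le_bottom_iff: "x \<in> carrier L \<Longrightarrow> x \<sqsubseteq> \<bottom> \<longleftrightarrow> x = \<bottom>"
  using le_antisym[of x \<bottom>] by auto

text \<open>In this form a comparison with a join becomes one with the members of \<open>A\<close>,
  also for empty \<open>A\<close>, whose join is bottom.\<close>

lemma is_lub_iff:
  assumes "A \<subseteq> carrier L"
  shows "is_lub L j A \<longleftrightarrow> j \<in> carrier L \<and> (\<forall>u\<in>carrier L. j \<sqsubseteq> u \<longleftrightarrow> (\<forall>a\<in>A. a \<sqsubseteq> u))"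
proof
  assume j: "is_lub L j A"
  then have jc: "j \<in> carrier L" by simp
  have aj: "a \<sqsubseteq> j" if "a \<in> A" for a
    using j that assms by (auto simp: least_def Upper_def)
  have "a \<sqsubseteq> u" if "a \<in> A" "u \<in> carrier L" "j \<sqsubseteq> u" for a u
    using le_trans[OF aj[OF that(1)] that(3)] that jc assms by blast
  then show "j \<in> carrier L \<and> (\<forall>u\<in>carrier L. j \<sqsubseteq> u \<longleftrightarrow> (\<forall>a\<in>A. a \<sqsubseteq> u))"
    using j jc by (auto simp: least_def Upper_def)
next
  assume "j \<in> carrier L \<and> (\<forall>u\<in>carrier L. j \<sqsubseteq> u \<longleftrightarrow> (\<forall>a\<in>A. a \<sqsubseteq> u))"
  then show "is_lub L j A"
    using assms by (auto simp: least_def Upper_def)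
qed

lemma is_lub_unique: "is_lub L j A \<Longrightarrow> is_lub L k A \<Longrightarrow> j = k"
  using weak_least_unique eq_is_equal by metis

text \<open>The set of upper bounds is non-empty because of \<open>u\<close>, and its meet is the
  join of \<open>A\<close>.\<close>

lemma bounded_has_lub:
  assumes A: "A \<subseteq> carrier L" and u: "u \<in> carrier L" "\<And>a. a \<in> A \<Longrightarrow> a \<sqsubseteq> u"
  obtains j where "is_lub L j A"
proof -
  have "Upper L A \<subseteq> carrier L" "u \<in> Upper L A"
    using u by (auto simp: Upper_def)
  then obtain j where j: "is_glb L j (Upper L A)"
    using semilattice unfolding finite_semilattice_def by blast
  have "is_lub L j A"
    using j A by (auto simp: least_def greatest_def Upper_def Lower_def)
  then show thesis by (rule that)
qed

lemma ex_maximal_above: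
  assumes "A \<subseteq> carrier L" "a \<in> A"
  obtains m where "m \<in> maximal_elems L A" "a \<sqsubseteq> m"
proof -
  let ?B = "{b \<in> A. a \<sqsubseteq> b}"
  have fin: "finite ?B"
    using assms(1) finite_carrier by (auto intro: finite_subset)
  have "\<exists>m\<in>?B. \<forall>x\<in>?B. x \<noteq> m \<longrightarrow> \<not> m \<sqsubset> x"
  proof (rule Finite_Set.bex_max_element[OF fin])
    show "asymp_on ?B (\<lambda>x y. x \<sqsubset> y)"
      using assms(1) by (auto simp: asymp_on_def lless_eq dest: le_antisym)
    show "transp_on ?B (\<lambda>x y. x \<sqsubset> y)"
      using assms(1) by (auto simp: transp_on_def intro: lless_trans)
    show "?B \<noteq> {}" using assms le_refl by blast
  qed
  then obtain m where m: "m \<in> A" "a \<sqsubseteq> m" "\<And>x. x \<in> A \<Longrightarrow> a \<sqsubseteq> x \<Longrightarrow> x \<noteq> m \<Longrightarrow> \<not> m \<sqsubset> x"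
    by blast
  have "\<not> m \<sqsubset> x" if "x \<in> A" for x
  proof
    assume less: "m \<sqsubset> x"
    then have "a \<sqsubseteq> x"
      using le_trans[OF m(2), of x] m(1) that assms unfolding lless_eq by blast
    then show False using m(3)[OF that] less by (auto simp: lless_eq)
  qed
  then show thesis
    using m by (intro that) (auto simp: maximal_elems_def)
qed

text \<open>Every \<open>s\<close> in \<open>S\<close> below \<open>x\<close> lies below some
  \<open>m\<close> in \<open>M\<close>, so it suffices that \<open>M\<close> is contained in
  \<open>H\<close>. If \<open>m\<close> in \<open>M\<close> were not in \<open>H\<close>, the
  members of \<open>H\<close> below \<open>m\<close> would have a join \<open>y\<close> strictly
  below \<open>m\<close>. Lowering the coordinate of \<open>x\<close> at \<open>m\<close> to that of
  \<open>y\<close> would then give an upper bound of \<open>H\<close> that is not above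
  \<open>x\<close>.\<close>

lemma building_set_le_lub_antichain:
  assumes build: "building_set L S" and nest: "nested_in L C S"
    and H: "H \<subseteq> C" "pairwise_incomparable L H"
    and x: "is_lub L x H" and s: "s \<in> S" "s \<sqsubseteq> x"
  obtains h where "h \<in> H" "s \<sqsubseteq> h"
proof -
  have S: "S \<subseteq> carrier L" "\<bottom> \<notin> S"
    using build by (auto simp: building_set_def)
  have HS: "H \<subseteq> S" "H \<subseteq> carrier L"
    using nest H S by (auto simp: nested_in_def)
  have xc: "x \<in> carrier L" using x by simp
  have sc: "s \<in> carrier L" using s S by auto
  have "x \<noteq> \<bottom>" using s S sc le_bottom_iff by metis
  define M where "M = maximal_elems L {s \<in> S. s \<sqsubseteq> x}"
  have M: "m \<in> S" "m \<sqsubseteq> x" "m \<in> carrier L" if "m \<in> M" for m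
    using that S by (auto simp: M_def maximal_elems_def)
  have above_M: "\<exists>m\<in>M. t \<sqsubseteq> m" if "t \<in> S" "t \<sqsubseteq> x" for t
    using ex_maximal_above[of "{s \<in> S. s \<sqsubseteq> x}" t] that S by (auto simp: M_def)
  define P where "P = product_poset M (\<lambda>m. interval_poset L \<bottom> m)"
  define e where "e m = (\<lambda>i\<in>M. if i = m then m else \<bottom>)" for m
  obtain \<phi> where iso: "poset_iso P (interval_poset L \<bottom> x) \<phi>" and \<phi>e: "\<And>m. m \<in> M \<Longrightarrow> \<phi> (e m) = m"
    using build xc \<open>x \<noteq> \<bottom>\<close> unfolding building_set_def Let_def M_def P_def e_def by blast
  have le_P: "f \<sqsubseteq>\<^bsub>P\<^esub> g \<longleftrightarrow> (\<forall>i\<in>M. f i \<sqsubseteq> g i)" for f g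
    by (simp add: P_def product_poset_def interval_poset_def)
  have carrier_P: "f \<in> carrier P \<longleftrightarrow> f \<in> extensional M \<and> (\<forall>i\<in>M. f i \<in> carrier L \<and> f i \<sqsubseteq> i)" for f
    by (auto simp: P_def product_poset_def interval_poset_def at_least_at_most_def PiE_iff)
  have \<phi>_le: "\<phi> f \<sqsubseteq> \<phi> g \<longleftrightarrow> (\<forall>i\<in>M. f i \<sqsubseteq> g i)" if "f \<in> carrier P" "g \<in> carrier P" for f g
    using iso that unfolding le_P[symmetric]
    by (simp add: poset_iso_def order_emb_def interval_poset_def)
  have \<phi>_img: "\<phi> ` carrier P = {y \<in> carrier L. y \<sqsubseteq> x}"
    using iso by (auto simp: poset_iso_def bij_betw_def interval_poset_def at_least_at_most_def)
  then have \<phi>c: "\<phi> f \<in> carrier L" if "f \<in> carrier P" for f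
    using that by auto
  have eP: "e m \<in> carrier P" for m
    using M by (auto simp: carrier_P e_def)
  have "m \<in> H" if m: "m \<in> M" for m
  proof (rule ccontr)
    assume mH: "m \<notin> H"
    define K where "K = {h \<in> H. h \<sqsubseteq> m}"
    have Kc: "K \<subseteq> carrier L" using HS by (auto simp: K_def)
    obtain y where y: "is_lub L y K"
      using bounded_has_lub[OF Kc M(3)[OF m]] by (auto simp: K_def)
    have yc: "y \<in> carrier L" using y by simp
    have ym: "y \<sqsubseteq> m" using y M(3)[OF m] unfolding is_lub_iff[OF Kc] by (simp add: K_def)
    \<comment> \<open>If \<open>m\<close> were the join of \<open>K\<close>, then \<open>K\<close>
      would not be empty, as \<open>m\<close> is not bottom, nor a singleton, as \<open>m\<close> is
      not in \<open>H\<close>. So \<open>K\<close> would be an antichain of at least two elements of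
      \<open>C\<close> with its join in \<open>S\<close>, against nestedness.\<close>
    have "y \<noteq> m"
    proof
      assume "y = m"
      then have m_lub: "is_lub L m K" using y by simp
      have "finite K" using Kc finite_carrier finite_subset by blast
      have "K \<noteq> {}"
      proof
        assume "K = {}"
        then have "m \<sqsubseteq> \<bottom>" using m_lub by (simp add: least_def)
        then show False using le_bottom_iff M[OF m] S by auto
      qed
      moreover have "\<not> (\<exists>k. K = {k})"
      proof
        assume "\<exists>k. K = {k}"
        then obtain k where k: "K = {k}" ..
        then have "k \<in> H" "k \<sqsubseteq> m" "k \<in> carrier L" using HS by (auto simp: K_def)
        moreover have "m \<sqsubseteq> k" using m_lub k Kc \<open>k \<in> carrier L\<close> by (auto simp: is_lub_iff)
        ultimately show False using mH M(3)[OF m] le_antisym[of m k] by auto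
      qed
      ultimately have "card K \<ge> 2"
        using \<open>finite K\<close> by (metis One_nat_def card_0_eq card_1_singletonE less_2_cases not_le)
      moreover have "K \<subseteq> C" "pairwise_incomparable L K"
        using H by (auto simp: K_def pairwise_incomparable_def intro: pairwise_subset)
      ultimately have "\<Squnion>K \<notin> S" using nest by (auto simp: nested_in_def)
      \<comment> \<open>The term \<open>\<Squnion>K\<close> is a choice term; it denotes a join
        because one exists, and uniqueness identifies it with \<open>m\<close>.\<close>
      moreover have "is_lub L (\<Squnion>K) K"
        unfolding sup_def using m_lub by (rule someI)
      ultimately show False
        using is_lub_unique[OF m_lub] M(1)[OF m] by auto
    qed
    have "y \<sqsubseteq> x" using ym M[OF m] yc xc le_trans by blast
    then have "y \<in> \<phi> ` carrier P" using yc \<phi>_img by simp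
    then obtain t where t: "t \<in> carrier P" "y = \<phi> t" by blast
    have "\<phi> t \<sqsubseteq> \<phi> (e m)" using \<phi>e[OF m] t(2) ym by simp
    \<comment> \<open>Being below the image of the unit vector \<open>e m\<close> forces all
      coordinates other than the one at \<open>m\<close> to be bottom.\<close>
    then have te: "\<forall>i\<in>M. t i \<sqsubseteq> e m i" using \<phi>_le[OF t(1) eP] by blast
    have t_bot: "t i = \<bottom>" if "i \<in> M" "i \<noteq> m" for i
      using te that t(1) le_bottom_iff carrier_P by (fastforce simp: e_def)
    have tm: "t m \<noteq> m"
    proof
      assume "t m = m"
      then have "t = e m"
        using t_bot t(1) m by (intro extensionalityI[of _ M]) (auto simp: carrier_P e_def)
      then show False using \<open>y \<noteq> m\<close> t(2) \<phi>e[OF m] by simp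
    qed
    \<comment> \<open>This is the top vector with its coordinate at \<open>m\<close> lowered. Its
      image is above \<open>y\<close> and above all other members of \<open>M\<close>, hence above
      all of \<open>H\<close>.\<close>
    define u where "u = (\<lambda>i\<in>M. if i = m then t m else i)"
    have uP: "u \<in> carrier P"
      using t(1) M by (auto simp: u_def carrier_P)
    have yu: "y \<sqsubseteq> \<phi> u"
      unfolding t(2) \<phi>_le[OF t(1) uP] using t_bot t(1) M by (auto simp: u_def carrier_P)
    have eu: "k \<sqsubseteq> \<phi> u" if k: "k \<in> M" "k \<noteq> m" for k
    proof -
      have "\<phi> (e k) \<sqsubseteq> \<phi> u"
        unfolding \<phi>_le[OF eP uP] using t(1) M k by (auto simp: u_def e_def carrier_P)
      then show ?thesis using \<phi>e k by simp
    qed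
    have "h \<sqsubseteq> \<phi> u" if h: "h \<in> H" for h
    proof -
      have hc: "h \<in> carrier L" using h HS by auto
      have "h \<sqsubseteq> x" using x h HS xc by (auto simp: is_lub_iff)
      then obtain k where k: "k \<in> M" "h \<sqsubseteq> k" using above_M h HS by blast
      show ?thesis
      proof (cases "k = m")
        case True
        then have "h \<in> K" using h k by (simp add: K_def)
        then have "h \<sqsubseteq> y" using y yc by (auto simp: is_lub_iff[OF Kc])
        then show ?thesis using yu le_trans hc yc \<phi>c[OF uP] by blast
      next
        case False
        then show ?thesis using eu k le_trans hc M(3)[OF k(1)] \<phi>c[OF uP] by blast
      qed
    qed
    then have "x \<sqsubseteq> \<phi> u" using x \<phi>c[OF uP] HS by (auto simp: is_lub_iff)
    \<comment> \<open>The image of the top vector is below \<open>x\<close>, hence below the image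
      of \<open>u\<close>; comparing coordinates at \<open>m\<close> gives the
      contradiction.\<close>
    moreover have "\<phi> (\<lambda>i\<in>M. i) \<sqsubseteq> x"
      using \<phi>_img M by (auto simp: carrier_P)
    moreover have idP: "(\<lambda>i\<in>M. i) \<in> carrier P" using M by (auto simp: carrier_P)
    ultimately have "\<phi> (\<lambda>i\<in>M. i) \<sqsubseteq> \<phi> u"
      using le_trans xc \<phi>c[OF uP] \<phi>c[OF idP] by blast
    then have "m \<sqsubseteq> t m" using m unfolding \<phi>_le[OF idP uP] by (auto simp: u_def)
    then show False using tm t(1) m M[OF m] le_antisym[of m "t m"] by (auto simp: carrier_P)
  qed
  then show thesis using above_M[OF s] that by blast
qed

text \<open>\<open>A\<close> and the antichain \<open>H\<close> of its maximal elements have the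
  same upper bounds, hence the same join, and the previous lemma applies to
  \<open>H\<close>.\<close>

lemma nested_has_lub:
  assumes build: "building_set L S" and nest: "nested_in L C S" and A: "A \<subseteq> C"
  obtains j where "is_lub L j A" "\<And>s. s \<in> S \<Longrightarrow> s \<sqsubseteq> j \<Longrightarrow> \<exists>a\<in>A. s \<sqsubseteq> a"
proof -
  have Ac: "A \<subseteq> carrier L"
    using nest A by (auto simp: nested_in_def)
  define H where "H = maximal_elems L A"
  have HA: "H \<subseteq> A" by (auto simp: H_def maximal_elems_def)
  have Hc: "H \<subseteq> carrier L" using HA Ac by auto
  have inc: "pairwise_incomparable L H"
    using Hc by (auto simp: pairwise_incomparable_def pairwise_def H_def maximal_elems_def lless_eq)
  have "\<exists>j. is_lub L j H"
  proof (cases "card H \<ge> 2")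
    case True
    then show ?thesis
      using nest inc HA A by (auto simp: nested_in_def has_join_def)
  next
    case False
    \<comment> \<open>Nestedness does not speak of antichains with fewer than two elements; these
      are bounded by bottom or by their only member.\<close>
    have "finite H" using Hc finite_carrier finite_subset by blast
    then consider "H = {}" | k where "H = {k}"
      using False by (metis One_nat_def card_0_eq card_1_singletonE less_2_cases not_le)
    then have "\<exists>u\<in>carrier L. \<forall>h\<in>H. h \<sqsubseteq> u"
      by cases (use Hc bottom_closed in auto)
    then show ?thesis using bounded_has_lub[OF Hc] by blast
  qed
  then obtain j where j: "is_lub L j H" ..
  have bound: "(\<forall>a\<in>A. a \<sqsubseteq> u) \<longleftrightarrow> (\<forall>a\<in>H. a \<sqsubseteq> u)" if "u \<in> carrier L" for u
  proof
    assume H: "\<forall>a\<in>H. a \<sqsubseteq> u"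
    show "\<forall>a\<in>A. a \<sqsubseteq> u"
    proof
      fix a assume a: "a \<in> A"
      obtain m where "m \<in> H" "a \<sqsubseteq> m" using ex_maximal_above[OF Ac a] unfolding H_def .
      then show "a \<sqsubseteq> u" using H le_trans[of a m u] that a Ac Hc by blast
    qed
  qed (use HA in blast)
  have "is_lub L j A"
    using j bound by (auto simp: is_lub_iff[OF Hc] is_lub_iff[OF Ac])
  moreover have "\<exists>a\<in>A. s \<sqsubseteq> a" if "s \<in> S" "s \<sqsubseteq> j" for s
    using building_set_le_lub_antichain[OF build nest _ inc j that] HA A by blast
  ultimately show thesis using that by blast
qed

end

section \<open>The elements of an iterated blow-up\<close>

text \<open>\<open>base\<close> and \<open>centers\<close> are the two coordinates of an element of
  an iterated blow-up. The nesting of the centers is forgotten; in the blow-up along a family it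
  follows the order of the family.\<close>

fun base :: "'a blowup_elem \<Rightarrow> 'a" where
  "base (Orig x) = x"
| "base (Exc \<xi> u) = base u"

fun centers :: "'a blowup_elem \<Rightarrow> 'a blowup_elem set" where
  "centers (Orig x) = {}"
| "centers (Exc \<xi> u) = insert \<xi> (centers u)"

text \<open>The candidate for the element with base \<open>x\<close> and the members of
  \<open>A\<close> in \<open>F\<close> as centers; later centers are wrapped outermost. It need not
  belong to the blow-up.\<close>

definition exc_chain :: "'a list \<Rightarrow> 'a set \<Rightarrow> 'a \<Rightarrow> 'a blowup_elem" where
  "exc_chain F A x = foldl (\<lambda>u \<xi>. if \<xi> \<in> A then Exc (Orig \<xi>) u else u) (Orig x) F"

lemma exc_chain_Nil [simp]: "exc_chain [] A x = Orig x"
  by (simp add: exc_chain_def)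

lemma exc_chain_snoc [simp]:
  "exc_chain (F @ [\<xi>]) A x = (if \<xi> \<in> A then Exc (Orig \<xi>) (exc_chain F A x) else exc_chain F A x)"
  by (simp add: exc_chain_def)

lemma base_exc_chain [simp]: "base (exc_chain F A x) = x"
  by (induction F rule: rev_induct) auto

lemma centers_exc_chain [simp]: "centers (exc_chain F A x) = Orig ` (set F \<inter> A)"
  by (induction F rule: rev_induct) auto

lemma exc_chain_empty: "set F \<inter> A = {} \<Longrightarrow> exc_chain F A x = Orig x"
  by (induction F rule: rev_induct) auto

lemma exc_chain_singleton:
  "distinct F \<Longrightarrow> \<xi> \<in> set F \<Longrightarrow> exc_chain F {\<xi>} x = Exc (Orig \<xi>) (Orig x)"
  by (induction F rule: rev_induct) (auto simp: exc_chain_empty)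

lemma blowup_family_Nil [simp]: "blowup_family L [] = orig_poset L"
  by (simp add: blowup_family_def)

lemma blowup_family_snoc [simp]:
  "blowup_family L (F @ [\<xi>]) = blowup (blowup_family L F) (Orig \<xi>)"
  by (simp add: blowup_family_def)

lemma eq_blowup_family: "eq (blowup_family L F) = (=)"
  by (induction F rule: rev_induct) (auto simp: orig_poset_def blowup_def)

lemma carrier_blowup:
  "carrier (blowup M \<xi>) =
     blowup_kept M \<xi> \<union> Exc \<xi> ` {x \<in> blowup_kept M \<xi>. has_join M {x, \<xi>}}"
  by (simp add: blowup_def)

text \<open>Freshness keeps old elements apart from new pairs, so each comparison matches only one
  rule of \<open>blowup_less\<close>. Reflexivity accounts for the case of equality, which
  \<open>blowup\<close> adds to the strict order.\<close>

lemma le_blowup: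
  assumes eq: "eq M = (=)" and refl: "\<And>x. x \<in> carrier M \<Longrightarrow> x \<sqsubseteq>\<^bsub>M\<^esub> x"
    and fresh: "\<And>x. Exc \<xi> x \<notin> carrier M"
    and x: "x \<in> blowup_kept M \<xi>" and y: "y \<in> blowup_kept M \<xi>"
  shows "x \<sqsubseteq>\<^bsub>blowup M \<xi>\<^esub> y \<longleftrightarrow> x \<sqsubseteq>\<^bsub>M\<^esub> y"
    and "x \<sqsubseteq>\<^bsub>blowup M \<xi>\<^esub> Exc \<xi> y \<longleftrightarrow> x \<sqsubseteq>\<^bsub>M\<^esub> y"
    and "Exc \<xi> x \<sqsubseteq>\<^bsub>blowup M \<xi>\<^esub> Exc \<xi> y \<longleftrightarrow> x \<sqsubseteq>\<^bsub>M\<^esub> y"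
    and "\<not> Exc \<xi> x \<sqsubseteq>\<^bsub>blowup M \<xi>\<^esub> y"
proof -
  have fresh': "Exc \<xi> z \<notin> blowup_kept M \<xi>" for z
    using fresh by (simp add: blowup_kept_def)
  have refl': "x \<sqsubseteq>\<^bsub>M\<^esub> x" using refl x by (simp add: blowup_kept_def)
  have less: "a \<sqsubset>\<^bsub>M\<^esub> b \<longleftrightarrow> a \<sqsubseteq>\<^bsub>M\<^esub> b \<and> a \<noteq> b" for a b
    by (simp add: lless_def eq)
  have ne: "x \<noteq> Exc \<xi> z" "y \<noteq> Exc \<xi> z" for z using x y fresh' by auto
  show "x \<sqsubseteq>\<^bsub>blowup M \<xi>\<^esub> y \<longleftrightarrow> x \<sqsubseteq>\<^bsub>M\<^esub> y"
    and "x \<sqsubseteq>\<^bsub>blowup M \<xi>\<^esub> Exc \<xi> y \<longleftrightarrow> x \<sqsubseteq>\<^bsub>M\<^esub> y"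
    and "Exc \<xi> x \<sqsubseteq>\<^bsub>blowup M \<xi>\<^esub> Exc \<xi> y \<longleftrightarrow> x \<sqsubseteq>\<^bsub>M\<^esub> y"
    and "\<not> Exc \<xi> x \<sqsubseteq>\<^bsub>blowup M \<xi>\<^esub> y"
    using x y fresh' refl' ne by (auto simp: blowup_def blowup_less.simps less)
qed

section \<open>Order, joins and membership in an iterated blow-up\<close>

context fin_semilattice
begin

lemma blowup_family_elem:
  assumes "u \<in> carrier (blowup_family L F)"
  shows "base u \<in> carrier L" and "centers u \<subseteq> Orig ` set F"
  using assms
  by (induction F arbitrary: u rule: rev_induct)
    (auto simp: orig_poset_def carrier_blowup blowup_kept_def; blast)+

text \<open>Each blow-up compares the old parts by the old order and adds one center. As
  \<open>F\<close> is distinct, this center does not occur in old elements, so inclusion of centers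
  says exactly that a new pair is never below an old element.\<close>

lemma le_blowup_family:
  assumes "distinct F" "u \<in> carrier (blowup_family L F)" "v \<in> carrier (blowup_family L F)"
  shows "u \<sqsubseteq>\<^bsub>blowup_family L F\<^esub> v \<longleftrightarrow> base u \<sqsubseteq> base v \<and> centers u \<subseteq> centers v"
  using assms
proof (induction F arbitrary: u v rule: rev_induct)
  case Nil
  then show ?case by (auto simp: orig_poset_def)
next
  case (snoc \<xi> F)
  let ?M = "blowup_family L F"
  have IH: "x \<sqsubseteq>\<^bsub>?M\<^esub> y \<longleftrightarrow> base x \<sqsubseteq> base y \<and> centers x \<subseteq> centers y"
    if "x \<in> carrier ?M" "y \<in> carrier ?M" for x y
    using snoc that by simp
  have refl: "x \<sqsubseteq>\<^bsub>?M\<^esub> x" if "x \<in> carrier ?M" for x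
    using IH that blowup_family_elem(1) by auto
  have fresh: "Exc (Orig \<xi>) x \<notin> carrier ?M" for x
    using Exc_fresh snoc.prems(1) by fastforce
  have le: "x \<sqsubseteq>\<^bsub>blowup ?M (Orig \<xi>)\<^esub> y \<longleftrightarrow> x \<sqsubseteq>\<^bsub>?M\<^esub> y"
      "x \<sqsubseteq>\<^bsub>blowup ?M (Orig \<xi>)\<^esub> Exc (Orig \<xi>) y \<longleftrightarrow> x \<sqsubseteq>\<^bsub>?M\<^esub> y"
      "Exc (Orig \<xi>) x \<sqsubseteq>\<^bsub>blowup ?M (Orig \<xi>)\<^esub> Exc (Orig \<xi>) y \<longleftrightarrow> x \<sqsubseteq>\<^bsub>?M\<^esub> y"
      "\<not> Exc (Orig \<xi>) x \<sqsubseteq>\<^bsub>blowup ?M (Orig \<xi>)\<^esub> y"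
    if "x \<in> blowup_kept ?M (Orig \<xi>)" "y \<in> blowup_kept ?M (Orig \<xi>)" for x y
    using le_blowup[where M = ?M and \<xi> = "Orig \<xi>", OF eq_blowup_family] refl fresh that
    by blast+
  have new: "Orig \<xi> \<notin> centers x" if "x \<in> carrier ?M" for x
    using blowup_family_elem(2)[OF that] snoc.prems(1) by auto
  have kept: "x \<in> carrier ?M" if "x \<in> blowup_kept ?M (Orig \<xi>)" for x
    using that by (simp add: blowup_kept_def)
  from snoc.prems(2,3) show ?case
    by (auto simp: carrier_blowup le IH kept subset_insert[OF new[OF kept]] dest: new[OF kept])
qed

text \<open>In a componentwise order a componentwise join is a join as soon as it belongs to the
  poset.\<close>

lemma has_join_blowup_family:
  assumes "distinct F" "U \<subseteq> carrier (blowup_family L F)" "w \<in> carrier (blowup_family L F)"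
    and "is_lub L (base w) (base ` U)" "centers w = \<Union> (centers ` U)"
  shows "has_join (blowup_family L F) U"
proof -
  let ?M = "blowup_family L F"
  have "base ` U \<subseteq> carrier L"
    using assms(2) blowup_family_elem(1) by blast
  then have lub: "base w \<sqsubseteq> z \<longleftrightarrow> (\<forall>u\<in>U. base u \<sqsubseteq> z)" if "z \<in> carrier L" for z
    using assms(4) that by (auto simp: is_lub_iff)
  have "w \<sqsubseteq>\<^bsub>?M\<^esub> v \<longleftrightarrow> (\<forall>u\<in>U. u \<sqsubseteq>\<^bsub>?M\<^esub> v)" if v: "v \<in> carrier ?M" for v
  proof -
    have "(\<forall>u\<in>U. u \<sqsubseteq>\<^bsub>?M\<^esub> v) \<longleftrightarrow> (\<forall>u\<in>U. base u \<sqsubseteq> base v \<and> centers u \<subseteq> centers v)"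
      using le_blowup_family[OF assms(1) _ v] assms(2) by blast
    also have "\<dots> \<longleftrightarrow> base w \<sqsubseteq> base v \<and> centers w \<subseteq> centers v"
      using lub[OF blowup_family_elem(1)[OF v]] assms(5) by auto
    finally show ?thesis using le_blowup_family[OF assms(1,3) v] by simp
  qed
  moreover have "w \<sqsubseteq>\<^bsub>?M\<^esub> w"
    using le_blowup_family[OF assms(1,3,3)] blowup_family_elem(1)[OF assms(3)] by simp
  ultimately have "is_lub ?M w U"
    using assms(2,3) by (auto simp: least_def Upper_def)
  then show ?thesis using assms(2) by (auto simp: has_join_def)
qed

text \<open>Only a center below \<open>x\<close> can remove \<open>Orig x\<close>. Sortedness lets
  each center survive until its own turn; the order of the blow-up can then be evaluated at it by
  \<open>le_blowup_family\<close>.\<close>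

lemma Orig_in_blowup_family:
  assumes "distinct F" "set F \<subseteq> carrier L" "x \<in> carrier L" "\<And>\<xi>. \<xi> \<in> set F \<Longrightarrow> \<not> \<xi> \<sqsubseteq> x"
    and sorted: "\<And>G \<xi> G' \<eta>. F = G @ \<xi> # G' \<Longrightarrow> \<eta> \<in> set G \<Longrightarrow> \<not> \<eta> \<sqsubseteq> \<xi>"
  shows "Orig x \<in> carrier (blowup_family L F)"
  using assms
proof (induction F arbitrary: x rule: rev_induct)
  case Nil
  then show ?case by (simp add: orig_poset_def)
next
  case (snoc \<xi> F)
  have sorted': "\<not> \<eta> \<sqsubseteq> \<zeta>" if "F = G @ \<zeta> # G'" "\<eta> \<in> set G" for G \<zeta> G' \<eta>
    using snoc.prems(5)[of G \<zeta> "G' @ [\<xi>]" \<eta>] that by simp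
  have x: "Orig x \<in> carrier (blowup_family L F)"
    by (rule snoc.IH) (use snoc.prems sorted' in auto)
  have \<xi>: "Orig \<xi> \<in> carrier (blowup_family L F)"
    by (rule snoc.IH) (use snoc.prems(1-4) snoc.prems(5)[of F \<xi> "[]"] sorted' in auto)
  show ?case
    using x snoc.prems le_blowup_family[OF _ \<xi> x] by (simp add: carrier_blowup blowup_kept_def)
qed

text \<open>\<open>F\<close> has been blown up and \<open>G\<close> is still to come; the induction
  moves the last center of \<open>F\<close> to the front of \<open>G\<close>, so
  \<open>F @ G\<close> stays fixed. The claim is made for all \<open>y\<close> below
  \<open>j\<close> because adding a center \<open>\<xi>\<close> requires the chain over the join of
  \<open>y\<close> and \<open>\<xi>\<close> at the preceding stage.\<close>

lemma exc_chain_in_blowup_family: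
  assumes dist: "distinct (F @ G)" and FG: "set (F @ G) \<subseteq> carrier L"
    and sorted: "\<And>G \<xi> G' \<eta>. F = G @ \<xi> # G' \<Longrightarrow> \<eta> \<in> set G \<Longrightarrow> \<not> \<eta> \<sqsubseteq> \<xi>"
    and join: "\<And>G1 G2. F @ G = G1 @ G2 \<Longrightarrow>
      \<exists>j. is_lub L j (set G2 \<inter> C) \<and> (\<forall>\<xi>\<in>set G1. \<not> \<xi> \<sqsubseteq> j)"
    and j: "is_lub L j (set G \<inter> C)" and y: "y \<in> carrier L" "y \<sqsubseteq> j"
  shows "exc_chain F C y \<in> carrier (blowup_family L F)"
  using assms
proof (induction F arbitrary: G j y rule: rev_induct)
  case Nil
  then show ?case by (simp add: orig_poset_def)
next
  case (snoc \<xi> F)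
  let ?M = "blowup_family L F"
  have dist: "distinct F" and \<xi>c: "\<xi> \<in> carrier L" and Gc: "set G \<subseteq> carrier L"
    using snoc.prems(1,2) by auto
  have sorted': "\<not> \<eta> \<sqsubseteq> \<zeta>" if "F = G @ \<zeta> # G'" "\<eta> \<in> set G" for G \<zeta> G' \<eta>
    using snoc.prems(3)[of G \<zeta> "G' @ [\<xi>]" \<eta>] that by simp
  have \<xi>: "Orig \<xi> \<in> carrier ?M"
    by (rule Orig_in_blowup_family)
      (use snoc.prems(1,2) snoc.prems(3)[of F \<xi> "[]"] sorted' in auto)
  have jc: "j \<in> carrier L" using snoc.prems(5) by simp
  \<comment> \<open>Splitting the family right after \<open>\<xi>\<close> shows that
    \<open>\<xi>\<close> is not below \<open>j\<close>, hence not below \<open>y\<close>.\<close>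
  have \<xi>y: "\<not> \<xi> \<sqsubseteq> y"
  proof
    assume "\<xi> \<sqsubseteq> y"
    then have "\<xi> \<sqsubseteq> j" using snoc.prems(6,7) jc \<xi>c le_trans by blast
    then show False
      using snoc.prems(4)[of "F @ [\<xi>]" G] snoc.prems(5) is_lub_unique by auto
  qed
  \<comment> \<open>Splitting right before \<open>\<xi>\<close> gives the bound \<open>k\<close> for
    the preceding stage; it is above \<open>j\<close> and, if \<open>\<xi>\<close> is in
    \<open>C\<close>, above \<open>\<xi>\<close>.\<close>
  obtain k where k: "is_lub L k (set (\<xi> # G) \<inter> C)"
    using snoc.prems(4)[of F "\<xi> # G"] by auto
  have kc: "k \<in> carrier L" using k by simp
  have sub: "set (\<xi> # G) \<inter> C \<subseteq> carrier L" "set G \<inter> C \<subseteq> carrier L"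
    using \<xi>c Gc by auto
  have IH: "exc_chain F C z \<in> carrier ?M" if "z \<in> carrier L" "z \<sqsubseteq> k" for z
    by (rule snoc.IH[of "\<xi> # G" k]) (use snoc.prems(1,2,4) sorted' k that in auto)
  have k_bound: "a \<sqsubseteq> k" if "a \<in> set (\<xi> # G) \<inter> C" for a
    using k kc that unfolding is_lub_iff[OF sub(1)] by (metis le_refl)
  have "j \<sqsubseteq> k"
    using snoc.prems(5) k_bound kc unfolding is_lub_iff[OF sub(2)] by auto
  then have "y \<sqsubseteq> k" using snoc.prems(6,7) jc kc le_trans by blast
  then have M: "exc_chain F C y \<in> carrier ?M" using IH snoc.prems(6) by blast
  then have kept: "exc_chain F C y \<in> blowup_kept ?M (Orig \<xi>)"
    using le_blowup_family[OF dist \<xi> M] \<xi>y by (simp add: blowup_kept_def)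
  show ?case
  proof (cases "\<xi> \<in> C")
    case True
    then have "\<xi> \<sqsubseteq> k" using k_bound by simp
    then obtain z where z: "is_lub L z {y, \<xi>}"
      using bounded_has_lub[of "{y, \<xi>}" k] \<open>y \<sqsubseteq> k\<close> \<xi>c kc snoc.prems(6) by auto
    have zc: "z \<in> carrier L" using z by simp
    have "z \<sqsubseteq> k"
      using z \<open>\<xi> \<sqsubseteq> k\<close> \<open>y \<sqsubseteq> k\<close> kc \<xi>c snoc.prems(6) by (simp add: is_lub_iff)
    then have "exc_chain F C z \<in> carrier ?M" using IH zc by blast
    \<comment> \<open>The chain over \<open>z\<close> is the componentwise join:
      \<open>Orig \<xi>\<close> contributes no centers.\<close>
    then have "has_join ?M {exc_chain F C y, Orig \<xi>}"
      by (intro has_join_blowup_family[where w = "exc_chain F C z"]) (use dist M \<xi> z in auto)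
    then show ?thesis using True kept by (simp add: carrier_blowup)
  next
    case False
    then show ?thesis using kept by (simp add: carrier_blowup)
  qed
qed

end

section \<open>The join of the elements (xi, 0)\<close>

theorem theorem4p3:
  fixes L :: "'a gorder" and F :: "'a list" and C :: "'a set"
  assumes "finite_semilattice L"
    and "family_in L F"
    and "sorted_family L F"
    and "C \<subseteq> set F"
    and "\<exists>S. building_set L S \<and> set F \<subseteq> S \<and> nested_in L C S"
  shows "has_join (blowup_family L F) (exc_elem L ` C)"
proof -
  interpret fin_semilattice L by standard (rule assms(1))
  obtain S where S: "building_set L S" "set F \<subseteq> S" "nested_in L C S"
    using assms(5) by blast
  have dist: "distinct F" and Fc: "set F \<subseteq> carrier L"
    using assms(2) by (auto simp: family_in_def)
  have sorted: "\<not> \<eta> \<sqsubseteq>\<^bsub>L\<^esub> \<xi>" if F: "F = G @ G'" and \<eta>: "\<eta> \<in> set G" and \<xi>: "\<xi> \<in> set G'" for G G' \<xi> \<eta>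
  proof
    assume le: "\<eta> \<sqsubseteq>\<^bsub>L\<^esub> \<xi>"
    obtain i where i: "i < length G" "G ! i = \<eta>" using \<eta> by (auto simp: in_set_conv_nth)
    obtain j where j: "j < length G'" "G' ! j = \<xi>" using \<xi> by (auto simp: in_set_conv_nth)
    have "\<eta> \<noteq> \<xi>" using dist \<eta> \<xi> F by auto
    with le have "\<eta> \<sqsubset>\<^bsub>L\<^esub> \<xi>" by (simp add: lless_eq)
    then have "F ! i \<sqsubset>\<^bsub>L\<^esub> F ! (length G + j)" using F i j by (simp add: nth_append)
    then have "length G + j < i"
      using assms(3) F i j unfolding sorted_family_def by simp
    then show False using i by simp
  qed
  \<comment> \<open>This is used for singletons, which give the elements (xi, 0), and for
    \<open>C\<close> itself, which gives their join. With no center left to come, \<open>j\<close>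
    is the empty join.\<close>
  have in_bl: "exc_chain F A \<bottom>\<^bsub>L\<^esub> \<in> carrier (blowup_family L F)" if A: "A \<subseteq> C" for A
  proof (rule exc_chain_in_blowup_family[where G = "[]" and j = "\<bottom>\<^bsub>L\<^esub>"])
    fix G1 G2 assume "F @ [] = G1 @ G2"
    then have F: "F = G1 @ G2" by simp
    obtain j where j: "is_lub L j (set G2 \<inter> A)"
      "\<And>s. s \<in> S \<Longrightarrow> s \<sqsubseteq>\<^bsub>L\<^esub> j \<Longrightarrow> \<exists>a\<in>set G2 \<inter> A. s \<sqsubseteq>\<^bsub>L\<^esub> a"
      using nested_has_lub[OF S(1,3), of "set G2 \<inter> A"] A by blast
    \<comment> \<open>Otherwise \<open>\<xi>\<close> would lie below a member of \<open>C\<close>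
      that comes later in the family.\<close>
    have "\<not> \<xi> \<sqsubseteq>\<^bsub>L\<^esub> j" if "\<xi> \<in> set G1" for \<xi>
      using j(2)[of \<xi>] sorted[OF F that] S(2) F that by auto
    then show "\<exists>j. is_lub L j (set G2 \<inter> A) \<and> (\<forall>\<xi>\<in>set G1. \<not> \<xi> \<sqsubseteq>\<^bsub>L\<^esub> j)"
      using j(1) by blast
  qed (use dist Fc sorted bottom_least in auto)
  have exc: "exc_elem L \<xi> = exc_chain F {\<xi>} \<bottom>\<^bsub>L\<^esub>" if "\<xi> \<in> C" for \<xi>
    using that assms(4) exc_chain_singleton[OF dist] by (auto simp: exc_elem_def)
  show ?thesis
  proof (rule has_join_blowup_family[OF dist])
    show "exc_elem L ` C \<subseteq> carrier (blowup_family L F)"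
      using exc in_bl by auto
    show "exc_chain F C \<bottom>\<^bsub>L\<^esub> \<in> carrier (blowup_family L F)"
      by (rule in_bl) simp
    \<comment> \<open>All bases are bottom; the inclusion instead of an equality covers empty
      \<open>C\<close>.\<close>
    have lub: "is_lub L \<bottom>\<^bsub>L\<^esub> X" if X: "X \<subseteq> {\<bottom>\<^bsub>L\<^esub>}" for X
    proof -
      have Xc: "X \<subseteq> carrier L" using X by auto
      show ?thesis unfolding is_lub_iff[OF Xc] using X by auto
    qed
    show "is_lub L (base (exc_chain F C \<bottom>\<^bsub>L\<^esub>)) (base ` exc_elem L ` C)"
      unfolding base_exc_chain by (rule lub) (auto simp: exc_elem_def)
    show "centers (exc_chain F C \<bottom>\<^bsub>L\<^esub>) = \<Union> (centers ` exc_elem L ` C)"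
      using assms(4) by (auto simp: exc_elem_def)
  qed
qed

end
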